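(* Let $\varepsilon>0$. Suppose $u_0\in C^2(\mathbb R)$ satisfies $$\sup_{x\in\mathbb R}\left(|u_0(x)|+|u_0'(x)|+|u_0''(x)|\right)<+\infty,\qquad \sup_{x_1,x_2\in\mathbb R,\ x_1\neq x_2}\frac{|u_0''(x_1)-u_0''(x_2)|}{|x_1-x_2|^\varepsilon}<+\infty,$$ and $\lim_{|x|\rightarrow+\infty}|x\,u_0'(x)|=0$. Let $u(x,t)$ be the solution to the Cauchy problem $$u_t(x,t)=\frac{u_{xx}(x,t)}{1+(u_x(x,t))^2},\quad (x,t)\in\mathbb R\times(0,+\infty),\qquad u(x,0)=u_0(x),\quad x\in\mathbb R.$$ Then, for all $L>0$, $$\lim_{t\rightarrow+\infty}\ \sup_{x\in[-L,+L]}\left|u(\sqrt t\,x,t)-\left(F(-x)\,u_0(-\sqrt t)+F(+x)\,u_0(+\sqrt t)\right)\right|=0,$$ where $F(z):=\frac{1}{2\sqrt\pi}\int_{-\infty}^z e^{-\frac{y^2}{4}}\,dy$.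
   Context: "The solution" means the classical solution of the stated Cauchy problem for the curvature flow equation of graphs. It is a known theorem of Nara and Taniguchi (J. Differential Equations 237 (2007), 61-76) that, under the first two displayed conditions on $u_0$, the maximal interval of existence of the classical solution is $[0,+\infty)$. *)

theory Defs
  imports "HOL-Analysis.Analysis"
begin

definition C2 :: "(real \<Rightarrow> real) \<Rightarrow> bool" where
  "C2 f \<longleftrightarrow>
     (\<forall>x. f differentiable (at x)) \<and>
     (\<forall>x. deriv f differentiable (at x)) \<and>
     continuous_on UNIV (deriv (deriv f))"

definition partial_t :: "(real \<Rightarrow> real \<Rightarrow> real) \<Rightarrow> real \<Rightarrow> real \<Rightarrow> real" where
  "partial_t u x t = deriv (\<lambda>s. u x s) t"

definition partial_x :: "(real \<Rightarrow> real \<Rightarrow> real) \<Rightarrow> real \<Rightarrow> real \<Rightarrow> real" where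
  "partial_x u x t = deriv (\<lambda>y. u y t) x"

definition partial_xx :: "(real \<Rightarrow> real \<Rightarrow> real) \<Rightarrow> real \<Rightarrow> real \<Rightarrow> real" where
  "partial_xx u = partial_x (partial_x u)"

text \<open>
  The library's \<open>deriv\<close> is total, so existence of the partial derivatives is
  required separately.  A classical solution is continuous up to the initial time and of
  class $C^{2,1}$ (two derivatives in space, one in time) at positive times; no
  growth condition at spatial infinity is imposed.  Values of \<open>u\<close> at negative
  times are irrelevant.
\<close>

definition classical_solution ::
  "(real \<Rightarrow> real) \<Rightarrow> (real \<Rightarrow> real \<Rightarrow> real) \<Rightarrow> bool" where
  "classical_solution u0 u \<longleftrightarrow>
     continuous_on (UNIV \<times> {0..}) (\<lambda>(x, t). u x t) \<and>
     (\<forall>x. \<forall>t>0. (\<lambda>s. u x s) differentiable (at t)) \<and>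
     (\<forall>x. \<forall>t>0. (\<lambda>y. u y t) differentiable (at x)) \<and>
     (\<forall>x. \<forall>t>0. (\<lambda>y. partial_x u y t) differentiable (at x)) \<and>
     continuous_on (UNIV \<times> {0<..}) (\<lambda>(x, t). partial_t u x t) \<and>
     continuous_on (UNIV \<times> {0<..}) (\<lambda>(x, t). partial_x u x t) \<and>
     continuous_on (UNIV \<times> {0<..}) (\<lambda>(x, t). partial_xx u x t) \<and>
     (\<forall>x. \<forall>t>0. partial_t u x t = partial_xx u x t / (1 + (partial_x u x t)\<^sup>2)) \<and>
     (\<forall>x. u x 0 = u0 x)"

definition F :: "real \<Rightarrow> real" where
  "F z = 1 / (2 * sqrt pi) * integral {..z} (\<lambda>y. exp (- (y\<^sup>2 / 4)))"

end

theory Submission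
  imports
    Defs
    "HOL-Probability.Weak_Convergence"
    "HOL-Probability.Distributions"
    "HOL-Real_Asymp.Real_Asymp"
begin

text \<open>
  Everything follows from the comparison principle on bounded rectangles. Grim reapers, which are
  infinite at the lateral ends of a strip of width $\pi R$, serve as barriers and show, as
  $R \to \infty$, that a solution stays between the bounds of its initial value although
  nothing is assumed at spatial infinity. The parabolic rescaling
  $w(y, s) = u(r y, r^2 s)$ with $r = \sqrt t$ solves $w_s = w_{yy} / (1 + r^{-2} w_y^2)$, and
  since $x u_0'(x) \to 0$ its initial value is, away from the origin and on bounded sets, close
  to the step from $u_0(-r)$ to $u_0(r)$. A solution of the heat equation with bounded
  derivatives becomes a supersolution after adding $O(r^{-2}) s$. The one used as barrier is the
  sum of a slightly smoothed step, a narrow bump that covers the origin and a parabola that covers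
  the lateral ends; at $s = 1$ bump and parabola are small and the step contributes
  $F(-y) u_0(-r) + F(y) u_0(r)$. The lower bound is the upper bound for $-u$.
\<close>

section \<open>The Gaussian kernel and its distribution function\<close>

definition gauss :: "real \<Rightarrow> real" where
  "gauss z = exp (- (z\<^sup>2 / 4)) / (2 * sqrt pi)"

lemma gauss_eq_normal_density: "gauss = normal_density 0 (sqrt 2)"
  by (auto simp: gauss_def normal_density_def fun_eq_iff real_sqrt_mult)

lemma integrable_gauss: "integrable lborel gauss"
  unfolding gauss_eq_normal_density by simp

lemma gauss_integrable_on: "gauss integrable_on S" if "S \<in> sets borel"
  by (rule set_borel_integral_eq_integral(1), unfold set_integrable_def)
     (use that integrable_gauss in \<open>intro integrable_mult_indicator, auto\<close>)

lemma F_eq_integral: "F z = integral {..z} gauss"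
  unfolding F_def gauss_def by simp

text \<open>Gives access to the general theory of distribution functions, which supplies the limits
  at both infinities, the bounds 0 and 1, and the monotonicity of \<open>F\<close>.\<close>

lemma F_eq_cdf: "F z = cdf (density lborel gauss) z"
proof -
  let ?M = "density lborel (\<lambda>x. ennreal (gauss x))"
  have "cdf ?M z = (LINT x|?M. indicator {..z} x)"
    by (simp add: cdf_def)
  also have "\<dots> = (LINT x|lborel. gauss x *\<^sub>R indicator {..z} x)"
    by (rule integral_density) (auto simp: gauss_eq_normal_density)
  also have "\<dots> = (LINT x:{..z}|lborel. gauss x)"
    by (simp add: set_lebesgue_integral_def mult.commute)
  also have "\<dots> = F z"
    unfolding F_eq_integral
    by (rule set_borel_integral_eq_integral(2), unfold set_integrable_def)
       (use integrable_gauss in \<open>intro integrable_mult_indicator, auto\<close>)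
  finally show ?thesis by simp
qed

lemma real_distribution_gauss: "real_distribution (density lborel gauss)"
  unfolding real_distribution_def real_distribution_axioms_def gauss_eq_normal_density
  by (simp add: prob_space_normal_density)

text \<open>The integral over the half-line is cut at \<open>z - 1\<close>, so that near
  \<open>z\<close> only an integral over a compact interval varies and the fundamental theorem of
  calculus applies.\<close>

lemma has_real_derivative_F: "(F has_real_derivative gauss z) (at z)"
proof -
  have eq: "F x = F (z - 1) + integral {z - 1..x} gauss" if "x \<in> {z-1<..<z+1}" for x
  proof -
    have "integral ({..z-1} \<union> {z-1..x}) gauss = integral {..z-1} gauss + integral {z-1..x} gauss"
      by (rule Henstock_Kurzweil_Integration.integral_Un)
         (auto intro: gauss_integrable_on negligible_subset[OF negligible_sing[of "z - 1"]])
    moreover have "{..z-1} \<union> {z-1..x} = {..x}"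
      using that by auto
    ultimately show ?thesis by (simp add: F_eq_integral)
  qed
  have "((\<lambda>x. integral {z-1..x} gauss) has_real_derivative gauss z) (at z within {z-1..z+1})"
    by (rule integral_has_real_derivative) (auto simp: gauss_def intro!: continuous_intros)
  then have "((\<lambda>x. integral {z-1..x} gauss) has_real_derivative gauss z) (at z)"
    by (simp add: at_within_Icc_at)
  then have "((\<lambda>x. F (z-1) + integral {z-1..x} gauss) has_real_derivative 0 + gauss z) (at z)"
    by (intro DERIV_add DERIV_const)
  then have "((\<lambda>x. F (z-1) + integral {z-1..x} gauss) has_real_derivative gauss z) (at z)"
    by simp
  then show ?thesis
    by (rule has_field_derivative_transform_within_open[where S="{z-1<..<z+1}"]) (use eq in auto)
qed
lemma tendsto_F: "(F \<longlongrightarrow> 1) at_top" "(F \<longlongrightarrow> 0) at_bot"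
  using real_distribution.cdf_lim_at_top_prob[OF real_distribution_gauss]
    finite_borel_measure.cdf_lim_at_bot[OF real_distribution.finite_borel_measure_M[OF real_distribution_gauss]]
  by (simp_all add: F_eq_cdf[abs_def])

lemma F_nonneg: "0 \<le> F z" and F_le_1: "F z \<le> 1"
  using real_distribution.cdf_bounded_prob[OF real_distribution_gauss]
    finite_borel_measure.cdf_nonneg[OF real_distribution.finite_borel_measure_M[OF real_distribution_gauss]]
  by (simp_all add: F_eq_cdf)

lemma F_mono: "x \<le> y \<Longrightarrow> F x \<le> F y"
  using finite_borel_measure.cdf_nondecreasing[OF real_distribution.finite_borel_measure_M[OF real_distribution_gauss]]
  by (simp add: F_eq_cdf)

text \<open>Since \<open>gauss\<close> is even, \<open>F x + F (- x)\<close> has derivative zero;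
  its constant value is read off from the limit at infinity.\<close>

lemma F_minus: "F (- z) = 1 - F z"
proof -
  have "((\<lambda>x. F x + F (- x)) has_real_derivative 0) (at x)" for x
    by (rule derivative_eq_intros DERIV_chain'[OF _ has_real_derivative_F] has_real_derivative_F refl)+
      (simp add: gauss_def)
  then have eq: "F x + F (- x) = F z + F (- z)" for x
    using DERIV_isconst_all[of "\<lambda>x. F x + F (- x)"] by blast
  have "((\<lambda>x. F x + F (- x)) \<longlongrightarrow> F z + F (- z)) at_top"
    by (subst eq) simp
  moreover have "((\<lambda>x. F x + F (- x)) \<longlongrightarrow> 1 + 0) at_top"
    by (intro tendsto_add tendsto_F(1) filterlim_compose[OF tendsto_F(2)] filterlim_uminus_at_bot_at_top)
  ultimately show ?thesis
    using tendsto_unique[of at_top "\<lambda>x. F x + F (- x)"] trivial_limit_at_top_linorder by fastforce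
qed

text \<open>The third quantity is the absolute value of the derivative of \<open>gauss\<close>.
  Sharp constants are irrelevant; only uniform bounds enter the barrier estimates.\<close>

lemma gauss_bounds: "0 \<le> gauss z" "gauss z \<le> 1" "\<bar>z * gauss z / 2\<bar> \<le> 1"
proof -
  have "2 * sqrt pi \<ge> 2"
    using pi_gt3 by (simp add: real_le_rsqrt)
  then have gauss_le: "gauss z \<le> exp (- (z\<^sup>2 / 4)) / 2"
    unfolding gauss_def by (intro divide_left_mono) auto
  show "0 \<le> gauss z" by (simp add: gauss_def)
  show "gauss z \<le> 1"
  proof -
    have "exp (- (z\<^sup>2 / 4)) \<le> 1" by simp
    then show ?thesis using gauss_le by linarith
  qed
  have "0 \<le> (\<bar>z\<bar> - 1)\<^sup>2" by simp
  then have "\<bar>z\<bar> / 4 \<le> 1 + z\<^sup>2 / 4"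
    by (simp add: power2_diff)
  also have "\<dots> \<le> exp (z\<^sup>2 / 4)"
    by (rule exp_ge_add_one_self)
  finally have "\<bar>z\<bar> / 4 * exp (- (z\<^sup>2 / 4)) \<le> 1"
    by (simp add: exp_minus field_simps)
  moreover have "\<bar>z * gauss z / 2\<bar> \<le> \<bar>z\<bar> / 2 * (exp (- (z\<^sup>2 / 4)) / 2)"
    using mult_left_mono[OF gauss_le, of "\<bar>z\<bar> / 2"] \<open>0 \<le> gauss z\<close> by (simp add: abs_mult)
  ultimately show "\<bar>z * gauss z / 2\<bar> \<le> 1"
    by linarith
qed

lemma F_lipschitz: "\<bar>F x - F y\<bar> \<le> \<bar>x - y\<bar>"
proof -
  have "norm (F x - F y) \<le> 1 * norm (x - y)"
    by (rule field_differentiable_bound[of UNIV _ gauss])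
       (use gauss_bounds in \<open>auto simp: has_real_derivative_F\<close>)
  then show ?thesis by simp
qed

section \<open>The maximum principle on a bounded rectangle\<close>

text \<open>If \<open>D\<close> were positive, \<open>f'\<close> would be positive just to the right
  of its zero \<open>x\<close>, and the mean value theorem would give larger values of
  \<open>f\<close> there.\<close>

lemma second_derivative_nonpos_at_max:
  fixes f f' :: "real \<Rightarrow> real"
  assumes "d > 0" and f: "\<And>y. \<bar>y - x\<bar> < d \<Longrightarrow> (f has_real_derivative f' y) (at y)"
    and f': "(f' has_real_derivative D) (at x)"
    and max: "\<And>y. \<bar>y - x\<bar> < d \<Longrightarrow> f y \<le> f x"
  shows "f' x = 0" "D \<le> 0"
proof -
  show f'x: "f' x = 0"
    using DERIV_local_max[OF f[of x] \<open>d > 0\<close>] max \<open>d > 0\<close> by (auto simp: abs_minus_commute)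
  show "D \<le> 0"
  proof (rule ccontr)
    assume "\<not> D \<le> 0"
    then obtain e where "e > 0" and e: "\<And>h. 0 < h \<Longrightarrow> h < e \<Longrightarrow> f' x < f' (x + h)"
      using DERIV_pos_inc_right[OF f'] by (metis not_le)
    define h where "h = min d e / 2"
    have h: "0 < h" "h < d" "h < e"
      using \<open>d > 0\<close> \<open>e > 0\<close> by (auto simp: h_def)
    have "\<exists>z. x < z \<and> z < x + h \<and> f (x + h) - f x = (x + h - x) * f' z"
      by (rule MVT2) (use h f in auto)
    then obtain z where z: "x < z" "z < x + h" "f (x + h) - f x = h * f' z"
      by auto
    have "f' z > 0"
      using e[of "z - x"] z h f'x by auto
    then show False
      using z h max[of "x + h"] by (smt (verit) mult_pos_pos)
  qed
qed

text \<open>A positive maximum cannot lie on the parabolic boundary, so the space derivatives there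
  satisfy the premises of \<open>sub\<close>. The negative time derivative then yields a larger
  value slightly earlier. Asking for \<open>sub\<close> only under these premises is what later
  admits a quasilinear equation without linearization.\<close>

lemma max_principle:
  fixes w :: "real \<Rightarrow> real \<Rightarrow> real"
  assumes cont: "continuous_on ({a..b} \<times> {0..T}) (\<lambda>(x, t). w x t)"
    and dt: "\<And>x t. a < x \<Longrightarrow> x < b \<Longrightarrow> 0 < t \<Longrightarrow> t \<le> T \<Longrightarrow> ((\<lambda>s. w x s) has_real_derivative wt x t) (at t)"
    and dx: "\<And>x t. a < x \<Longrightarrow> x < b \<Longrightarrow> 0 < t \<Longrightarrow> t \<le> T \<Longrightarrow> ((\<lambda>y. w y t) has_real_derivative wx x t) (at x)"
    and dxx: "\<And>x t. a < x \<Longrightarrow> x < b \<Longrightarrow> 0 < t \<Longrightarrow> t \<le> T \<Longrightarrow> ((\<lambda>y. wx y t) has_real_derivative wxx x t) (at x)"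
    and sub: "\<And>x t. a < x \<Longrightarrow> x < b \<Longrightarrow> 0 < t \<Longrightarrow> t \<le> T \<Longrightarrow> wx x t = 0 \<Longrightarrow> wxx x t \<le> 0 \<Longrightarrow> wt x t < 0"
    and init: "\<And>x. a \<le> x \<Longrightarrow> x \<le> b \<Longrightarrow> w x 0 \<le> 0"
    and lateral: "\<And>t. 0 \<le> t \<Longrightarrow> t \<le> T \<Longrightarrow> w a t \<le> 0 \<and> w b t \<le> 0"
    and x: "a \<le> x" "x \<le> b" and t: "0 \<le> t" "t \<le> T"
  shows "w x t \<le> 0"
proof (rule ccontr)
  assume "\<not> w x t \<le> 0"
  have "compact ({a..b} \<times> {0..T})"
    by (intro compact_Times) auto
  moreover have "{a..b} \<times> {0..T} \<noteq> {}"
    using x t by auto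
  ultimately obtain p where p: "p \<in> {a..b} \<times> {0..T}"
    and pmax: "\<And>q. q \<in> {a..b} \<times> {0..T} \<Longrightarrow> (\<lambda>(x, t). w x t) q \<le> (\<lambda>(x, t). w x t) p"
    using continuous_attains_sup[OF _ _ cont] by metis
  obtain y s where [simp]: "p = (y, s)" by (cases p)
  have max: "w y' s' \<le> w y s" if "a \<le> y'" "y' \<le> b" "0 \<le> s'" "s' \<le> T" for y' s'
    using pmax[of "(y', s')"] that by auto
  have pos: "w y s > 0"
    using max[of x t] x t \<open>\<not> w x t \<le> 0\<close> by auto
  have y: "a < y" "y < b" and s: "0 < s" "s \<le> T"
    using p pos init[of y] lateral[of s] by (auto simp: order.order_iff_strict)
  have "((\<lambda>y. w y s) has_real_derivative wx z s) (at z)" "w z s \<le> w y s"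
    if "\<bar>z - y\<bar> < min (y - a) (b - y)" for z
    using that dx[of z s] max[of z s] s by auto
  moreover have "min (y - a) (b - y) > 0" using y by simp
  ultimately have "wx y s = 0" "wxx y s \<le> 0"
    using second_derivative_nonpos_at_max[where f="\<lambda>y. w y s" and f'="\<lambda>y. wx y s", OF _ _ dxx[OF y s]]
    by blast+
  then have "wt y s < 0"
    using sub y s by auto
  \<comment> \<open>Only earlier times are compared, because the maximum may sit at the final time
    \<open>T\<close>.\<close>
  then obtain d where "d > 0" and d: "\<And>h. 0 < h \<Longrightarrow> h < d \<Longrightarrow> w y s < w y (s - h)"
    using DERIV_neg_dec_left[OF dt[OF y s]] by auto
  show False
    using d[of "min d s / 2"] max[of y "s - min d s / 2"] \<open>d > 0\<close> y s by linarith
qed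

section \<open>Graph flows, their symmetries and the comparison principle\<close>

text \<open>\<open>p\<close> and \<open>q\<close> play the role of $u_x$ and $u_{xx}$; the factor \<open>\<mu>\<close> is produced
  by parabolic rescaling.\<close>
definition graph_flow :: "real \<Rightarrow> (real \<Rightarrow> real \<Rightarrow> real) \<Rightarrow> bool" where
  "graph_flow \<mu> u \<longleftrightarrow>
     continuous_on (UNIV \<times> {0..}) (\<lambda>(x, t). u x t) \<and>
     (\<exists>p q. \<forall>x. \<forall>t>0.
        ((\<lambda>s. u x s) has_real_derivative q x t / (1 + \<mu> * (p x t)\<^sup>2)) (at t) \<and>
        ((\<lambda>y. u y t) has_real_derivative p x t) (at x) \<and>
        ((\<lambda>y. p y t) has_real_derivative q x t) (at x))"

lemma graph_flow_classical_solution: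
  assumes "classical_solution u0 u"
  shows "graph_flow 1 u"
proof -
  have *: "((\<lambda>s. u x s) has_real_derivative partial_xx u x t / (1 + 1 * (partial_x u x t)\<^sup>2)) (at t)"
      "((\<lambda>y. u y t) has_real_derivative partial_x u x t) (at x)"
      "((\<lambda>y. partial_x u y t) has_real_derivative partial_xx u x t) (at x)"
    if "t > 0" for x t
  proof -
    have d: "(\<lambda>s. u x s) differentiable (at t)" "(\<lambda>y. u y t) differentiable (at x)"
        "(\<lambda>y. partial_x u y t) differentiable (at x)"
      and eq: "partial_t u x t = partial_xx u x t / (1 + (partial_x u x t)\<^sup>2)"
      using assms that by (auto simp: classical_solution_def)
    show "((\<lambda>s. u x s) has_real_derivative partial_xx u x t / (1 + 1 * (partial_x u x t)\<^sup>2)) (at t)"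
      using d(1) eq by (simp add: partial_t_def flip: DERIV_deriv_iff_real_differentiable)
    show "((\<lambda>y. u y t) has_real_derivative partial_x u x t) (at x)"
      using d(2) by (simp add: partial_x_def DERIV_deriv_iff_real_differentiable)
    show "((\<lambda>y. partial_x u y t) has_real_derivative partial_xx u x t) (at x)"
      using d(3) by (simp add: partial_xx_def partial_x_def[of "partial_x u"] DERIV_deriv_iff_real_differentiable)
  qed
  have "continuous_on (UNIV \<times> {0..}) (\<lambda>(x, t). u x t)"
    using assms by (simp add: classical_solution_def)
  with * show ?thesis
    unfolding graph_flow_def by blast
qed

lemma graph_flow_minus:
  assumes "graph_flow \<mu> u"
  shows "graph_flow \<mu> (\<lambda>x t. - u x t)"
proof -
  obtain p q where *: "\<And>x t. t > 0 \<Longrightarrow> ((\<lambda>s. u x s) has_real_derivative q x t / (1 + \<mu> * (p x t)\<^sup>2)) (at t)"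
      "\<And>x t. t > 0 \<Longrightarrow> ((\<lambda>y. u y t) has_real_derivative p x t) (at x)"
      "\<And>x t. t > 0 \<Longrightarrow> ((\<lambda>y. p y t) has_real_derivative q x t) (at x)"
    and cont: "continuous_on (UNIV \<times> {0..}) (\<lambda>(x, t). u x t)"
    using assms unfolding graph_flow_def by blast
  have "continuous_on (UNIV \<times> {0..}) (\<lambda>(x, t). - u x t)"
    using continuous_on_minus[OF cont] by (simp add: case_prod_beta')
  moreover have "((\<lambda>s. - u x s) has_real_derivative - q x t / (1 + \<mu> * (- p x t)\<^sup>2)) (at t)"
    "((\<lambda>y. - u y t) has_real_derivative - p x t) (at x)"
    "((\<lambda>y. - p y t) has_real_derivative - q x t) (at x)" if "t > 0" for x t
    using *[OF that, THEN DERIV_minus] by simp_all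
  ultimately show ?thesis
    unfolding graph_flow_def
    by (intro conjI exI[of _ "\<lambda>x t. - p x t", OF exI[of _ "\<lambda>x t. - q x t"]]) auto
qed

text \<open>Time derivative and second space derivative both gain the factor
  \<open>r\<^sup>2\<close>, but the slope gains \<open>r\<close>; the coefficient
  \<open>1 / r\<^sup>2\<close> undoes this in the denominator.\<close>

lemma graph_flow_rescale:
  assumes "graph_flow 1 u" "r > 0"
  shows "graph_flow (1 / r\<^sup>2) (\<lambda>x t. u (r * x) (r\<^sup>2 * t))"
proof -
  obtain p q where *: "\<And>x t. t > 0 \<Longrightarrow> ((\<lambda>s. u x s) has_real_derivative q x t / (1 + (p x t)\<^sup>2)) (at t)"
      "\<And>x t. t > 0 \<Longrightarrow> ((\<lambda>y. u y t) has_real_derivative p x t) (at x)"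
      "\<And>x t. t > 0 \<Longrightarrow> ((\<lambda>y. p y t) has_real_derivative q x t) (at x)"
    and cont: "continuous_on (UNIV \<times> {0..}) (\<lambda>(x, t). u x t)"
    using assms(1) unfolding graph_flow_def mult_1 by blast
  have "continuous_on (UNIV \<times> {0..}) ((\<lambda>(x, t). u x t) \<circ> (\<lambda>(x, t). (r * x, r\<^sup>2 * t)))"
    by (intro continuous_on_compose continuous_on_subset[OF cont])
       (auto simp: case_prod_beta' intro!: continuous_intros)
  then have "continuous_on (UNIV \<times> {0..}) (\<lambda>(x, t). u (r * x) (r\<^sup>2 * t))"
    by (simp add: o_def case_prod_beta')
  moreover have "((\<lambda>s. u (r * x) (r\<^sup>2 * s)) has_real_derivative
      r\<^sup>2 * q (r * x) (r\<^sup>2 * t) / (1 + 1 / r\<^sup>2 * (r * p (r * x) (r\<^sup>2 * t))\<^sup>2)) (at t)"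
     "((\<lambda>y. u (r * y) (r\<^sup>2 * t)) has_real_derivative r * p (r * x) (r\<^sup>2 * t)) (at x)"
     "((\<lambda>y. r * p (r * y) (r\<^sup>2 * t)) has_real_derivative r\<^sup>2 * q (r * x) (r\<^sup>2 * t)) (at x)"
    if "t > 0" for x t
  proof -
    have "r\<^sup>2 * t > 0" using that assms(2) by simp
    note * = *[OF this]
    have dt: "((\<lambda>s. r\<^sup>2 * s) has_real_derivative r\<^sup>2) (at t)"
      and dx: "((\<lambda>y. r * y) has_real_derivative r) (at x)"
      by (auto intro!: derivative_eq_intros)
    show "((\<lambda>s. u (r * x) (r\<^sup>2 * s)) has_real_derivative
      r\<^sup>2 * q (r * x) (r\<^sup>2 * t) / (1 + 1 / r\<^sup>2 * (r * p (r * x) (r\<^sup>2 * t))\<^sup>2)) (at t)"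
      using DERIV_chain2[OF *(1) dt] assms(2) by (simp add: power_mult_distrib mult.commute)
    show "((\<lambda>y. u (r * y) (r\<^sup>2 * t)) has_real_derivative r * p (r * x) (r\<^sup>2 * t)) (at x)"
      using DERIV_chain2[OF *(2) dx] by (simp add: mult.commute)
    show "((\<lambda>y. r * p (r * y) (r\<^sup>2 * t)) has_real_derivative r\<^sup>2 * q (r * x) (r\<^sup>2 * t)) (at x)"
      using DERIV_cmult[OF DERIV_chain2[OF *(3) dx], of r] by (simp add: power2_eq_square mult_ac)
  qed
  ultimately show ?thesis
    unfolding graph_flow_def
    by (intro conjI exI[of _ "\<lambda>x t. r * p (r * x) (r\<^sup>2 * t)",
          OF exI[of _ "\<lambda>x t. r\<^sup>2 * q (r * x) (r\<^sup>2 * t)"]]) auto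
qed

text \<open>At a critical point of \<open>u - h\<close> the two slopes agree, so the denominators of
  the two equations agree as well and only the second derivatives have to be compared. Strictness in
  \<open>super\<close> gives the strict sign that the maximum principle asks for.\<close>

lemma graph_flow_comparison:
  fixes u h :: "real \<Rightarrow> real \<Rightarrow> real"
  assumes flow: "graph_flow \<mu> u" and "\<mu> \<ge> 0"
    and cont: "continuous_on ({a..b} \<times> {0..T}) (\<lambda>(x, t). h x t)"
    and dt: "\<And>x t. a < x \<Longrightarrow> x < b \<Longrightarrow> 0 < t \<Longrightarrow> t \<le> T \<Longrightarrow> ((\<lambda>s. h x s) has_real_derivative ht x t) (at t)"
    and dx: "\<And>x t. a < x \<Longrightarrow> x < b \<Longrightarrow> 0 < t \<Longrightarrow> t \<le> T \<Longrightarrow> ((\<lambda>y. h y t) has_real_derivative hx x t) (at x)"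
    and dxx: "\<And>x t. a < x \<Longrightarrow> x < b \<Longrightarrow> 0 < t \<Longrightarrow> t \<le> T \<Longrightarrow> ((\<lambda>y. hx y t) has_real_derivative hxx x t) (at x)"
    and super: "\<And>x t. a < x \<Longrightarrow> x < b \<Longrightarrow> 0 < t \<Longrightarrow> t \<le> T \<Longrightarrow> hxx x t / (1 + \<mu> * (hx x t)\<^sup>2) < ht x t"
    and init: "\<And>x. a \<le> x \<Longrightarrow> x \<le> b \<Longrightarrow> u x 0 \<le> h x 0"
    and lateral: "\<And>t. 0 \<le> t \<Longrightarrow> t \<le> T \<Longrightarrow> u a t \<le> h a t \<and> u b t \<le> h b t"
    and x: "a \<le> x" "x \<le> b" and t: "0 \<le> t" "t \<le> T"
  shows "u x t \<le> h x t"
proof -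
  obtain p q where *: "\<And>x t. t > 0 \<Longrightarrow> ((\<lambda>s. u x s) has_real_derivative q x t / (1 + \<mu> * (p x t)\<^sup>2)) (at t)"
      "\<And>x t. t > 0 \<Longrightarrow> ((\<lambda>y. u y t) has_real_derivative p x t) (at x)"
      "\<And>x t. t > 0 \<Longrightarrow> ((\<lambda>y. p y t) has_real_derivative q x t) (at x)"
    and contu: "continuous_on (UNIV \<times> {0..}) (\<lambda>(x, t). u x t)"
    using flow unfolding graph_flow_def by blast
  have "continuous_on ({a..b} \<times> {0..T}) (\<lambda>(x, t). u x t)"
    by (rule continuous_on_subset[OF contu]) auto
  from continuous_on_diff[OF this cont]
  have contw: "continuous_on ({a..b} \<times> {0..T}) (\<lambda>(x, t). u x t - h x t)"
    by (simp add: case_prod_beta')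
  have "u x t - h x t \<le> 0"
  proof (rule max_principle[where w="\<lambda>x t. u x t - h x t", OF contw])
    fix x t assume xt: "a < x" "x < b" "0 < t" "t \<le> T"
    show "((\<lambda>s. u x s - h x s) has_real_derivative q x t / (1 + \<mu> * (p x t)\<^sup>2) - ht x t) (at t)"
      by (intro DERIV_diff * dt xt)
    show "((\<lambda>y. u y t - h y t) has_real_derivative p x t - hx x t) (at x)"
      by (intro DERIV_diff * dx xt)
    show "((\<lambda>y. p y t - hx y t) has_real_derivative q x t - hxx x t) (at x)"
      by (intro DERIV_diff * dxx xt)
    assume "p x t - hx x t = 0" "q x t - hxx x t \<le> 0"
    then have "q x t / (1 + \<mu> * (p x t)\<^sup>2) \<le> hxx x t / (1 + \<mu> * (hx x t)\<^sup>2)"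
      using \<open>\<mu> \<ge> 0\<close> by (simp add: divide_right_mono)
    also have "\<dots> < ht x t" by (rule super[OF xt])
    finally show "q x t / (1 + \<mu> * (p x t)\<^sup>2) - ht x t < 0" by simp
  qed (use init lateral x t in auto)
  then show ?thesis by simp
qed

section \<open>A priori bound by grim reapers\<close>

text \<open>The grim reaper \<open>t / R - R * ln (cos (x / R))\<close> is a translating solution.
  Doubling its speed to \<open>2 / R\<close> makes it a strict supersolution, and at a fixed point
  the barrier tends to \<open>M\<close> as \<open>R\<close> grows.\<close>

lemma graph_flow_le_initial_bound:
  assumes flow: "graph_flow 1 u" and M: "\<And>x. u x 0 \<le> M" and "t \<ge> 0"
  shows "u x t \<le> M"
proof -
  have barrier: "u x t \<le> M + 2 * t / R - R * ln (cos (x / R))" if "R > \<bar>x\<bar>" "R > 0" for R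
  proof -
    \<comment> \<open>The bound \<open>N\<close> on the box of half-width \<open>2 * R\<close> is
      fixed before the strip of half-width \<open>z * R\<close> is chosen. As
      \<open>z < pi / 2 < 2\<close>, that strip lies inside the box.\<close>
    have "compact ({-2*R..2*R} \<times> {0..t})"
      by (intro compact_Times) auto
    moreover have "continuous_on ({-2*R..2*R} \<times> {0..t}) (\<lambda>(x, t). u x t)"
      by (rule continuous_on_subset[of "UNIV \<times> {0..}"]) (use flow in \<open>auto simp: graph_flow_def\<close>)
    ultimately have "bounded ((\<lambda>(x, t). u x t) ` ({-2*R..2*R} \<times> {0..t}))"
      by (metis compact_imp_bounded compact_continuous_image)
    then obtain N where N: "\<And>y s. y \<in> {-2*R..2*R} \<Longrightarrow> s \<in> {0..t} \<Longrightarrow> \<bar>u y s\<bar> \<le> N"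
      unfolding bounded_iff by (metis (no_types, lifting) case_prod_conv image_eqI mem_Sigma_iff real_norm_def)
    have "((\<lambda>z. cos z) \<longlongrightarrow> cos (pi/2)) (at_left (pi/2))"
      by (intro tendsto_intros)
    then have "filterlim cos (at_right 0) (at_left (pi/2))"
      by (auto simp: filterlim_at eventually_at_left_field less_imp_neq[symmetric] cos_gt_zero
          intro!: exI[of _ "0"])
    then have "filterlim (\<lambda>z. ln (cos z)) at_bot (at_left (pi/2))"
      by (rule filterlim_compose[OF ln_at_0])
    then have "eventually (\<lambda>z. ln (cos z) \<le> - (N + \<bar>M\<bar>) / R) (at_left (pi/2))"
      by (simp add: filterlim_at_bot)
    moreover have "eventually (\<lambda>z. z \<in> {1<..<pi/2}) (at_left (pi/2))"
      by (intro eventually_at_leftI[of 1]) (use pi_gt3 in auto)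
    ultimately have "eventually (\<lambda>z. ln (cos z) \<le> - (N + \<bar>M\<bar>) / R \<and> z \<in> {1<..<pi/2}) (at_left (pi/2))"
      by (rule eventually_conj)
    \<comment> \<open>So close to \<open>pi / 2\<close> the barrier exceeds \<open>N\<close> at the
      ends of the strip; \<open>1 < z\<close> keeps \<open>x\<close> inside, since
      \<open>\<bar>x\<bar> < R\<close>.\<close>
    then obtain z where z: "ln (cos z) \<le> - (N + \<bar>M\<bar>) / R" "1 < z" "z < pi/2"
      using eventually_happens[of _ "at_left (pi/2)"] by (auto simp: trivial_limit_at_left_real)
    have cos_pos: "cos (y / R) > 0" if "y \<in> {-(z*R)..z*R}" for y
    proof -
      have "\<bar>y / R\<bar> \<le> z"
        using that \<open>R > 0\<close> by (auto simp: abs_le_iff field_simps)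
      then have "- (pi / 2) < y / R" "y / R < pi / 2"
        using z by linarith+
      then show ?thesis
        by (rule cos_gt_zero_pi)
    qed
    have zR: "z * R \<le> 2 * R" "R \<le> z * R"
      using z pi_less_4 \<open>R > 0\<close> by auto
    show ?thesis
    proof (rule graph_flow_comparison[where h="\<lambda>x t. M + 2 * t / R - R * ln (cos (x / R))" and T=t
          and a="-(z*R)" and b="z*R" and ht="\<lambda>_ _. 2 / R" and hx="\<lambda>x t. tan (x / R)"
          and hxx="\<lambda>x t. 1 / (R * (cos (x / R))\<^sup>2)", OF flow])
      show "continuous_on ({-(z*R)..z*R} \<times> {0..t}) (\<lambda>(x, t). M + 2 * t / R - R * ln (cos (x / R)))"
        using cos_pos \<open>R > 0\<close>
        by (auto simp: case_prod_beta' intro!: continuous_intros) (metis atLeastAtMost_iff less_irrefl)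
    next
      fix y s assume y: "-(z*R) < y" "y < z*R"
      then have c: "cos (y / R) > 0" using cos_pos by auto
      have dy: "((\<lambda>y. y / R) has_real_derivative 1 / R) (at y)"
        using \<open>R > 0\<close> by (auto intro!: derivative_eq_intros)
      have "((\<lambda>y. ln (cos (y / R))) has_real_derivative 1 / cos (y / R) * (- sin (y / R) * (1 / R))) (at y)"
        by (rule DERIV_chain2[OF DERIV_ln_divide[OF c] DERIV_chain2[OF DERIV_cos dy]])
      from DERIV_diff[OF DERIV_const[of "M + 2 * s / R"] DERIV_cmult[OF this, of R]]
      show "((\<lambda>y. M + 2 * s / R - R * ln (cos (y / R))) has_real_derivative tan (y / R)) (at y)"
        using \<open>R > 0\<close> by (simp add: tan_def)
      have "cos (y / R) \<noteq> 0" using c by simp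
      from DERIV_chain2[OF DERIV_tan[OF this] dy]
      show "((\<lambda>y. tan (y / R)) has_real_derivative 1 / (R * (cos (y / R))\<^sup>2)) (at y)"
        by (simp add: field_simps)
      \<comment> \<open>The squared cosine cancels: the right-hand side of the flow equation is
        exactly \<open>1 / R\<close>, half the speed of the barrier.\<close>
      have "1 + (tan (y / R))\<^sup>2 = 1 / (cos (y / R))\<^sup>2"
        using c tan_sec[of "y / R"] by (simp add: field_simps)
      then show "1 / (R * (cos (y / R))\<^sup>2) / (1 + 1 * (tan (y / R))\<^sup>2) < 2 / R"
        using c \<open>R > 0\<close> by (simp add: field_simps)
      show "((\<lambda>s. M + 2 * s / R - R * ln (cos (y / R))) has_real_derivative 2 / R) (at s)"
        using \<open>R > 0\<close> by (auto intro!: derivative_eq_intros)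
    next
      fix y assume "-(z*R) \<le> y" "y \<le> z*R"
      then have "ln (cos (y / R)) \<le> 0"
        using cos_pos[of y] by (simp add: ln_le_zero_iff)
      then have "R * ln (cos (y / R)) \<le> 0"
        using \<open>R > 0\<close> by (simp add: mult_nonneg_nonpos)
      then show "u y 0 \<le> M + 2 * 0 / R - R * ln (cos (y / R))"
        using M[of y] by simp
    next
      fix s assume s: "0 \<le> s" "s \<le> t"
      have "R * ln (cos z) \<le> - (N + \<bar>M\<bar>)"
        using z(1) \<open>R > 0\<close> by (simp add: field_simps)
      moreover have "2 * s / R \<ge> 0" using s \<open>R > 0\<close> by simp
      moreover have "\<bar>u (-(z*R)) s\<bar> \<le> N" "\<bar>u (z*R) s\<bar> \<le> N"
        by (rule N; use zR s \<open>R > 0\<close> in \<open>unfold atLeastAtMost_iff, linarith\<close>)+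
      moreover have cosz: "cos (-(z*R) / R) = cos z" "cos (z*R / R) = cos z"
        using \<open>R > 0\<close> by simp_all
      ultimately show "u (-(z*R)) s \<le> M + 2 * s / R - R * ln (cos (-(z*R) / R)) \<and>
          u (z*R) s \<le> M + 2 * s / R - R * ln (cos (z*R / R))"
        unfolding cosz by linarith
    qed (insert that zR \<open>t \<ge> 0\<close>, linarith+)
  qed
  have "((\<lambda>R. M + 2 * t / R - R * ln (cos (x / R))) \<longlongrightarrow> M) at_top"
    by real_asymp
  moreover have "eventually (\<lambda>R. u x t \<le> M + 2 * t / R - R * ln (cos (x / R))) at_top"
    using eventually_gt_at_top[of "\<bar>x\<bar>"] eventually_gt_at_top[of 0] by eventually_elim (rule barrier)
  ultimately show ?thesis
    by (intro tendsto_lowerbound[where F=at_top]) auto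
qed

section \<open>Smoothed steps as solutions of the heat equation\<close>

text \<open>The solution of the heat equation that starts at time \<open>- d\<close> from the unit
  jump at \<open>c\<close>. Starting earlier makes it smooth at time 0, with derivatives bounded in
  terms of \<open>d\<close>.\<close>

definition heat_step :: "real \<Rightarrow> real \<Rightarrow> real \<Rightarrow> real \<Rightarrow> real" where
  "heat_step d c x t = F ((x - c) / sqrt (t + d))"

definition heat_step_x :: "real \<Rightarrow> real \<Rightarrow> real \<Rightarrow> real \<Rightarrow> real" where
  "heat_step_x d c x t = gauss ((x - c) / sqrt (t + d)) / sqrt (t + d)"

definition heat_step_xx :: "real \<Rightarrow> real \<Rightarrow> real \<Rightarrow> real \<Rightarrow> real" where
  "heat_step_xx d c x t =
     - (((x - c) / sqrt (t + d)) * gauss ((x - c) / sqrt (t + d)) / 2) / (t + d)"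

lemma has_real_derivative_gauss: "(gauss has_real_derivative - (z * gauss z / 2)) (at z)"
proof -
  have "((\<lambda>z. exp (- (z\<^sup>2 / 4))) has_real_derivative exp (- (z\<^sup>2 / 4)) * (- (z / 2))) (at z)"
    by (rule derivative_eq_intros refl | simp)+
  from DERIV_cdivide[OF this, of "2 * sqrt pi"] show ?thesis
    by (simp add: gauss_def[abs_def] mult_ac)
qed

text \<open>The second and third claims share \<open>heat_step_xx\<close>, which is the heat
  equation. It rests on the profile equation \<open>F'' = - z * F' / 2\<close>, that is, on the
  derivative of \<open>gauss\<close>.\<close>

lemma heat_step_derivs:
  assumes "t \<ge> 0" "d > 0"
  shows "((\<lambda>y. heat_step d c y t) has_real_derivative heat_step_x d c x t) (at x)"
    and "((\<lambda>y. heat_step_x d c y t) has_real_derivative heat_step_xx d c x t) (at x)"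
    and "((\<lambda>s. heat_step d c x s) has_real_derivative heat_step_xx d c x t) (at t)"
proof -
  have pos: "t + d > 0" using assms by simp
  then have sq: "sqrt (t + d) * sqrt (t + d) = t + d" by simp
  have dx: "((\<lambda>y. (y - c) / sqrt (t + d)) has_real_derivative 1 / sqrt (t + d)) (at x)"
    using DERIV_cdivide[OF DERIV_diff[OF DERIV_ident DERIV_const]] by simp
  have dt: "((\<lambda>s. (x - c) / sqrt (s + d)) has_real_derivative
      - ((x - c) / sqrt (t + d)) / (2 * (t + d))) (at t)"
  proof -
    have "((\<lambda>s. sqrt (s + d)) has_real_derivative 1 / (2 * sqrt (t + d))) (at t)"
      using pos by (auto intro!: derivative_eq_intros simp: inverse_eq_divide)
    moreover have "sqrt (t + d) \<noteq> 0" using pos by simp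
    ultimately have "((\<lambda>s. (x - c) / sqrt (s + d)) has_real_derivative
        (0 * sqrt (t + d) - (x - c) * (1 / (2 * sqrt (t + d)))) / (sqrt (t + d) * sqrt (t + d))) (at t)"
      by (intro DERIV_divide DERIV_const)
    moreover have "(0 * q - a * (1 / (2 * q))) / (q * q) = - (a / q) / (2 * (q * q))" for a q :: real
      by simp
    ultimately show ?thesis using sq by metis
  qed
  show "((\<lambda>y. heat_step d c y t) has_real_derivative heat_step_x d c x t) (at x)"
    unfolding heat_step_def heat_step_x_def
    using DERIV_chain2[OF has_real_derivative_F dx] by simp
  show "((\<lambda>y. heat_step_x d c y t) has_real_derivative heat_step_xx d c x t) (at x)"
    unfolding heat_step_x_def heat_step_xx_def
    by (rule DERIV_cong[OF DERIV_cdivide[OF DERIV_chain2[OF has_real_derivative_gauss dx]]])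
       (simp only: mult_1_right times_divide_eq_right divide_divide_eq_left sq)
  show "((\<lambda>s. heat_step d c x s) has_real_derivative heat_step_xx d c x t) (at t)"
  proof -
    have eq: "g * (- z / (2 * T)) = - (z * g / 2) / T" for g z T :: real
      by simp
    show ?thesis
      unfolding heat_step_def heat_step_xx_def
      by (rule DERIV_cong[OF DERIV_chain2[OF has_real_derivative_F dt] eq])
  qed
qed

lemma heat_step_bounds:
  assumes "t \<ge> 0" "d > 0"
  shows "0 \<le> heat_step_x d c x t" "heat_step_x d c x t \<le> 1 / sqrt d" "\<bar>heat_step_xx d c x t\<bar> \<le> 1 / d"
proof -
  show "0 \<le> heat_step_x d c x t"
    using gauss_bounds assms by (simp add: heat_step_x_def)
  show "heat_step_x d c x t \<le> 1 / sqrt d"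
    unfolding heat_step_x_def using gauss_bounds assms by (intro frac_le) auto
  show "\<bar>heat_step_xx d c x t\<bar> \<le> 1 / d"
    unfolding heat_step_xx_def abs_divide[of _ "t + d"] abs_minus_cancel
    using assms by (intro frac_le gauss_bounds(3)) auto
qed

lemma continuous_on_heat_step:
  assumes "d > 0"
  shows "continuous_on (UNIV \<times> {0..}) (\<lambda>(x, t). heat_step d c x t)"
proof -
  have "continuous_on UNIV F"
    using has_real_derivative_F DERIV_isCont by (auto intro!: continuous_at_imp_continuous_on)
  then show ?thesis
    unfolding heat_step_def case_prod_beta'
    by (rule continuous_on_compose2) (use assms in \<open>auto intro!: continuous_intros\<close>)
qed

section \<open>Barriers built from solutions of the heat equation\<close>

text \<open>Replacing \<open>vxx\<close> by \<open>vxx / (1 + \<mu> * vx\<^sup>2)\<close> changes it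
  by at most \<open>\<mu> * Q * P\<^sup>2\<close>, so adding a slightly larger multiple of time
  turns \<open>v\<close> into a strict supersolution.\<close>

lemma graph_flow_le_heat_solution:
  fixes u v :: "real \<Rightarrow> real \<Rightarrow> real"
  assumes flow: "graph_flow \<mu> u" and "\<mu> \<ge> 0"
    and cont: "continuous_on ({a..b} \<times> {0..T}) (\<lambda>(x, t). v x t)"
    and dt: "\<And>x t. a < x \<Longrightarrow> x < b \<Longrightarrow> 0 < t \<Longrightarrow> t \<le> T \<Longrightarrow> ((\<lambda>s. v x s) has_real_derivative vxx x t) (at t)"
    and dx: "\<And>x t. a < x \<Longrightarrow> x < b \<Longrightarrow> 0 < t \<Longrightarrow> t \<le> T \<Longrightarrow> ((\<lambda>y. v y t) has_real_derivative vx x t) (at x)"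
    and dxx: "\<And>x t. a < x \<Longrightarrow> x < b \<Longrightarrow> 0 < t \<Longrightarrow> t \<le> T \<Longrightarrow> ((\<lambda>y. vx y t) has_real_derivative vxx x t) (at x)"
    and P: "\<And>x t. a < x \<Longrightarrow> x < b \<Longrightarrow> 0 < t \<Longrightarrow> t \<le> T \<Longrightarrow> \<bar>vx x t\<bar> \<le> P"
    and Q: "\<And>x t. a < x \<Longrightarrow> x < b \<Longrightarrow> 0 < t \<Longrightarrow> t \<le> T \<Longrightarrow> \<bar>vxx x t\<bar> \<le> Q"
    and init: "\<And>x. a \<le> x \<Longrightarrow> x \<le> b \<Longrightarrow> u x 0 \<le> v x 0"
    and lateral: "\<And>t. 0 \<le> t \<Longrightarrow> t \<le> T \<Longrightarrow> u a t \<le> v a t \<and> u b t \<le> v b t"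
    and x: "a < x" "x < b" and t: "0 < t" "t \<le> T"
  shows "u x t \<le> v x t + \<mu> * Q * P\<^sup>2 * t"
proof (rule field_le_epsilon)
  have "Q \<ge> 0" using Q[OF x t] by linarith
  fix e :: real assume "e > 0"
  \<comment> \<open>The extra slope \<open>e / t\<close> provides strictness and costs exactly
    \<open>e\<close> at the time of evaluation.\<close>
  define k where "k = \<mu> * Q * P\<^sup>2 + e / t"
  have k: "k \<ge> 0" "k > \<mu> * Q * P\<^sup>2"
    using \<open>\<mu> \<ge> 0\<close> \<open>Q \<ge> 0\<close> \<open>e > 0\<close> t by (auto simp: k_def)
  have "u x t \<le> v x t + k * t"
  proof (rule graph_flow_comparison[where h="\<lambda>x t. v x t + k * t" and ht="\<lambda>x t. vxx x t + k"
         and hx=vx and hxx=vxx and a=a and b=b and T=T, OF flow \<open>\<mu> \<ge> 0\<close>])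
    show "continuous_on ({a..b} \<times> {0..T}) (\<lambda>(x, t). v x t + k * t)"
      using cont unfolding case_prod_beta' by (intro continuous_intros)
    fix x t assume xt: "a < x" "x < b" "0 < t" "t \<le> T"
    show "((\<lambda>s. v x s + k * s) has_real_derivative vxx x t + k) (at t)"
      by (rule derivative_eq_intros dt xt refl)+ simp
    show "((\<lambda>y. v y t + k * t) has_real_derivative vx x t) (at x)"
      by (rule derivative_eq_intros dx xt refl)+ simp
    show "((\<lambda>y. vx y t) has_real_derivative vxx x t) (at x)"
      by (rule dxx[OF xt])
    define m where "m = \<mu> * (vx x t)\<^sup>2"
    have "(vx x t)\<^sup>2 \<le> P\<^sup>2"
      using P[OF xt] by (metis abs_ge_zero power2_abs power_mono)
    then have m: "0 \<le> m" "m \<le> \<mu> * P\<^sup>2"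
      using \<open>\<mu> \<ge> 0\<close> by (auto simp: m_def mult_left_mono)
    have "vxx x t / (1 + m) - vxx x t = - vxx x t * (m / (1 + m))"
      using m by (simp add: field_simps)
    also have "\<dots> \<le> Q * (\<mu> * P\<^sup>2)"
    proof (rule mult_mono)
      show "m / (1 + m) \<le> \<mu> * P\<^sup>2"
        using m frac_le[of m m 1 "1 + m"] by simp
    qed (use Q[OF xt] m \<open>Q \<ge> 0\<close> in auto)
    also have "\<dots> < k" using k by (simp add: mult_ac)
    finally show "vxx x t / (1 + \<mu> * (vx x t)\<^sup>2) < vxx x t + k"
      by (simp add: m_def)
  next
    fix s assume "0 \<le> s" "s \<le> T"
    then show "u a s \<le> v a s + k * s \<and> u b s \<le> v b s + k * s"
      using lateral[of s] k mult_nonneg_nonneg[of k s] by linarith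
  qed (use init x t in auto)
  then show "u x t \<le> v x t + \<mu> * Q * P\<^sup>2 * t + e"
    using t by (simp add: k_def algebra_simps)
qed

text \<open>Bounds the effect at time 1 of having smoothed the step by the time \<open>d\<close>:
  \<open>F\<close> is 1-Lipschitz and \<open>1 - 1 / sqrt (1 + d)\<close> is at most
  \<open>d\<close>.\<close>

lemma F_rescale_le:
  assumes "d \<ge> 0" "\<bar>x\<bar> \<le> L"
  shows "\<bar>F (x / sqrt (1 + d)) - F x\<bar> \<le> L * d"
proof -
  have "sqrt (1 + d) \<le> 1 + d"
    using assms by (intro real_le_lsqrt) (auto simp: power2_eq_square algebra_simps)
  then have "1 / (1 + d) \<le> 1 / sqrt (1 + d)"
    using assms by (intro frac_le) auto
  moreover have "1 - 1 / (1 + d) \<le> d"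
    using assms by (simp add: field_simps)
  ultimately have "1 - 1 / sqrt (1 + d) \<le> d" by linarith
  moreover have "1 / sqrt (1 + d) \<le> 1" using assms by simp
  ultimately have "\<bar>1 / sqrt (1 + d) - 1\<bar> \<le> d" by linarith
  then have "\<bar>x\<bar> * \<bar>1 / sqrt (1 + d) - 1\<bar> \<le> L * d"
    using assms by (intro mult_mono) auto
  moreover have "\<bar>F (x / sqrt (1 + d)) - F x\<bar> \<le> \<bar>x * (1 / sqrt (1 + d) - 1)\<bar>"
    using F_lipschitz[of "x / sqrt (1 + d)" x] by (simp add: algebra_simps)
  ultimately show ?thesis by (simp add: abs_mult)
qed

text \<open>In the bracket, \<open>2 * M * (L * \<eta>^4)\<close> is the cost of smoothing the step,
  \<open>16 * M * \<eta>\<close> the bump at time 1 and the last term the tails of the smoothed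
  step. Then follow the parabola, the oscillation \<open>\<omega>\<close> of the initial value, and
  the correction from the previous comparison.\<close>

lemma graph_flow_le_step:
  assumes flow: "graph_flow \<mu> w" and "\<mu> \<ge> 0"
    and M: "\<And>x t. t \<ge> 0 \<Longrightarrow> w x t \<le> M" "\<bar>A\<bar> \<le> M" "\<bar>B\<bar> \<le> M"
    and \<eta>: "\<eta> > 0" "F (1 / \<eta>) \<ge> 3/4" and "\<omega> \<ge> 0"
    and right: "\<And>x. \<eta> \<le> x \<Longrightarrow> x \<le> R \<Longrightarrow> w x 0 \<le> B + \<omega>"
    and left: "\<And>x. \<eta> \<le> x \<Longrightarrow> x \<le> R \<Longrightarrow> w (- x) 0 \<le> A + \<omega>"
    and x: "\<bar>x\<bar> \<le> L" and "L < R"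
  shows "w x 1 \<le> F (- x) * A + F x * B + (2 * M * (L * \<eta>^4) + 16 * M * \<eta> + 2 * M * F (- 1 / \<eta>))
    + 2 * M * (L\<^sup>2 + 2) / R\<^sup>2 + \<omega> + \<mu> * (10 * M / \<eta>^4 + 4 * M / R\<^sup>2) * (10 * M / \<eta>\<^sup>2 + 4 * M / R)\<^sup>2"
proof -
  \<comment> \<open>The transition layer then has width \<open>sqrt d = \<eta>\<^sup>2\<close>, so
    that points at distance \<open>\<eta>\<close> from a jump lie \<open>1 / \<eta>\<close> widths
    away.\<close>
  define d where "d = \<eta>^4"
  have d: "d > 0" "sqrt d = \<eta>\<^sup>2"
    using \<eta> by (auto simp: d_def intro!: real_sqrt_unique)
  have "M \<ge> 0" using M by linarith
  have "R > 0" using x \<open>L < R\<close> by linarith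
  \<comment> \<open>In order: the step from \<open>A\<close> to \<open>B\<close>; a bump of nominal
    height \<open>4 * M\<close> between \<open>- 2 * \<eta>\<close> and \<open>2 * \<eta>\<close>; a
    parabolic solution of the heat equation; a constant that absorbs \<open>\<omega>\<close> and the
    tails of the step.\<close>
  define v where "v = (\<lambda>x t. A + (B - A) * heat_step d 0 x t
      + 4 * M * (heat_step d (- 2 * \<eta>) x t - heat_step d (2 * \<eta>) x t)
      + 2 * M / R\<^sup>2 * (x\<^sup>2 + 2 * t) + (\<omega> + 2 * M * F (- 1 / \<eta>)))"
  define vx where "vx = (\<lambda>x t. (B - A) * heat_step_x d 0 x t
      + 4 * M * (heat_step_x d (- 2 * \<eta>) x t - heat_step_x d (2 * \<eta>) x t) + 2 * M / R\<^sup>2 * (2 * x))"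
  define vxx where "vxx = (\<lambda>x t. (B - A) * heat_step_xx d 0 x t
      + 4 * M * (heat_step_xx d (- 2 * \<eta>) x t - heat_step_xx d (2 * \<eta>) x t) + 2 * M / R\<^sup>2 * 2)"
  \<comment> \<open>The step part may be as low as \<open>- M\<close>, so bump or parabola must
    supply \<open>2 * M\<close> wherever only the bound \<open>M\<close> on \<open>w\<close> is
    available.\<close>
  have step: "- M \<le> A + (B - A) * z" if "0 \<le> z" "z \<le> 1" for z
  proof -
    have "A + (B - A) * z = (1 - z) * A + z * B" by (simp add: algebra_simps)
    also have "\<dots> \<ge> (1 - z) * (- M) + z * (- M)"
      using that M by (intro add_mono mult_left_mono) auto
    finally show ?thesis by (simp add: algebra_simps)
  qed
  have bump: "heat_step d (2 * \<eta>) y t \<le> heat_step d (- 2 * \<eta>) y t" if "t \<ge> 0" for y t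
    unfolding heat_step_def using that d \<eta> by (intro F_mono divide_right_mono) auto
  have small: "\<omega> + 2 * M * F (- 1 / \<eta>) \<ge> 0"
    using \<open>M \<ge> 0\<close> \<open>\<omega> \<ge> 0\<close> F_nonneg by simp
  have par: "2 * M / R\<^sup>2 * (y\<^sup>2 + 2 * t) \<ge> 0" if "t \<ge> 0" for y t
    using that \<open>M \<ge> 0\<close> by simp
  have "w x 1 \<le> v x 1 + \<mu> * (10 * M / d + 4 * M / R\<^sup>2) * (10 * M / sqrt d + 4 * M / R)\<^sup>2 * 1"
  proof (rule graph_flow_le_heat_solution[where v=v and vx=vx and vxx=vxx and a="-R" and b=R and T=1, OF flow \<open>\<mu> \<ge> 0\<close>])
    have "continuous_on ({-R..R} \<times> {0..1}) (\<lambda>(x, t). heat_step d c x t)" for c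
      by (rule continuous_on_subset[OF continuous_on_heat_step]) (use d in auto)
    then show "continuous_on ({-R..R} \<times> {0..1}) (\<lambda>(x, t). v x t)"
      unfolding v_def case_prod_beta' by (intro continuous_intros)
  next
    fix y t :: real assume yt: "-R < y" "y < R" "0 < t" "t \<le> 1"
    note D = heat_step_derivs[OF less_imp_le[OF \<open>0 < t\<close>] d(1)]
    note N = heat_step_bounds[OF less_imp_le[OF \<open>0 < t\<close>] d(1)]
    show "((\<lambda>s. v y s) has_real_derivative vxx y t) (at t)"
      unfolding v_def vxx_def by (rule derivative_eq_intros D refl)+ simp
    show "((\<lambda>y. v y t) has_real_derivative vx y t) (at y)"
      unfolding v_def vx_def by (rule derivative_eq_intros D refl)+ simp
    show "((\<lambda>y. vx y t) has_real_derivative vxx y t) (at y)"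
      unfolding vx_def vxx_def by (rule derivative_eq_intros D refl)+ simp
    \<comment> \<open>The factor 10 is 2 from \<open>\<bar>B - A\<bar> \<le> 2 * M\<close> plus 8
      from the two bump terms with coefficient \<open>4 * M\<close>.\<close>
    have comb: "\<bar>(B - A) * a0 + 4 * M * (a1 - a2)\<bar> \<le> 10 * (M * K)"
      if "\<bar>a0\<bar> \<le> K" "\<bar>a1\<bar> \<le> K" "\<bar>a2\<bar> \<le> K" for a0 a1 a2 K
    proof -
      have "\<bar>(B - A) * a0\<bar> \<le> (2 * M) * K"
        unfolding abs_mult using M that by (intro mult_mono) auto
      moreover have "\<bar>4 * M * (a1 - a2)\<bar> \<le> (4 * M) * (2 * K)"
        unfolding abs_mult using \<open>M \<ge> 0\<close> that by (intro mult_mono) auto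
      ultimately show ?thesis by linarith
    qed
    have x_par: "\<bar>2 * M / R\<^sup>2 * (2 * y)\<bar> \<le> 4 * M / R"
    proof -
      have "\<bar>2 * M / R\<^sup>2 * (2 * y)\<bar> \<le> 2 * M / R\<^sup>2 * (2 * R)"
        unfolding abs_mult using \<open>M \<ge> 0\<close> yt by (intro mult_mono) auto
      then show ?thesis using \<open>R > 0\<close> by (simp add: power2_eq_square)
    qed
    have "\<bar>(B - A) * heat_step_x d 0 y t
        + 4 * M * (heat_step_x d (- 2 * \<eta>) y t - heat_step_x d (2 * \<eta>) y t)\<bar> \<le> 10 * (M * (1 / sqrt d))"
      by (intro comb) (use N in auto)
    then show "\<bar>vx y t\<bar> \<le> 10 * M / sqrt d + 4 * M / R"
      unfolding vx_def using order_trans[OF abs_triangle_ineq add_mono[OF _ x_par]] by simp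
    have xx_par: "\<bar>2 * M / R\<^sup>2 * 2\<bar> \<le> 4 * M / R\<^sup>2"
      using \<open>M \<ge> 0\<close> by simp
    have "\<bar>(B - A) * heat_step_xx d 0 y t
        + 4 * M * (heat_step_xx d (- 2 * \<eta>) y t - heat_step_xx d (2 * \<eta>) y t)\<bar> \<le> 10 * (M * (1 / d))"
      by (intro comb N(3))
    then show "\<bar>vxx y t\<bar> \<le> 10 * M / d + 4 * M / R\<^sup>2"
      unfolding vxx_def using order_trans[OF abs_triangle_ineq add_mono[OF _ xx_par]] by simp
  next
    fix y :: real assume y: "-R \<le> y" "y \<le> R"
    have F_far: "F (z / \<eta>\<^sup>2) \<le> F (- 1 / \<eta>)" if "z \<le> - \<eta>" for z
      using that \<eta> by (intro F_mono) (simp add: divide_simps power2_eq_square)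
    have F_far': "F (1 / \<eta>) \<le> F (z / \<eta>\<^sup>2)" if "z \<ge> \<eta>" for z
      using that \<eta> by (intro F_mono) (simp add: divide_simps power2_eq_square)
    have flip: "F (- 1 / \<eta>) = 1 - F (1 / \<eta>)"
      using F_minus[of "1 / \<eta>"] by simp
    have F01: "0 \<le> F (z)" "F z \<le> 1" for z
      using F_nonneg F_le_1 by auto
    have bump0: "4 * M * (heat_step d (- 2 * \<eta>) y 0 - heat_step d (2 * \<eta>) y 0) \<ge> 0"
      using bump[of 0 y] \<open>M \<ge> 0\<close> by simp
    consider "\<bar>y\<bar> \<le> \<eta>" | "\<eta> \<le> y" | "y \<le> - \<eta>" by linarith
    then show "w y 0 \<le> v y 0"
    proof cases
      \<comment> \<open>Near the origin only \<open>w \<le> M\<close> is known. Both edges of the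
        bump are at least \<open>\<eta>\<close> away, so \<open>F (1 / \<eta>) \<ge> 3/4\<close>
        leaves it at least half its height, which is \<open>2 * M\<close>.\<close>
      case 1
      have "heat_step d (- 2 * \<eta>) y 0 = F ((y + 2 * \<eta>) / \<eta>\<^sup>2)"
        "heat_step d (2 * \<eta>) y 0 = F ((y - 2 * \<eta>) / \<eta>\<^sup>2)"
        using d by (simp_all add: heat_step_def)
      moreover have "F ((y - 2 * \<eta>) / \<eta>\<^sup>2) \<le> F (- 1 / \<eta>)" "F (1 / \<eta>) \<le> F ((y + 2 * \<eta>) / \<eta>\<^sup>2)"
        using 1 by (intro F_far F_far'; linarith)+
      ultimately have "heat_step d (- 2 * \<eta>) y 0 - heat_step d (2 * \<eta>) y 0 \<ge> 1 / 2"
        using flip \<eta>(2) by linarith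
      from mult_left_mono[OF this, of "4 * M"]
      have "4 * M * (heat_step d (- 2 * \<eta>) y 0 - heat_step d (2 * \<eta>) y 0) \<ge> 2 * M"
        using \<open>M \<ge> 0\<close> by simp
      moreover have "A + (B - A) * heat_step d 0 y 0 \<ge> - M"
        by (intro step) (auto simp: heat_step_def F01)
      ultimately show ?thesis
        using small par[of 0 y] M(1)[of 0 y] unfolding v_def by linarith
    next
      \<comment> \<open>Here the smoothed step misses its limit \<open>B\<close> by at most the tail
        \<open>2 * M * F (- 1 / \<eta>)\<close>, which the constant in \<open>v\<close> pays
        for.\<close>
      case 2
      have "(B - A) * (1 - heat_step d 0 y 0) \<le> (2 * M) * F (- 1 / \<eta>)"
        using F_far'[OF 2] flip d M \<open>M \<ge> 0\<close> F01 by (intro mult_mono) (auto simp: heat_step_def)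
      then have "A + (B - A) * heat_step d 0 y 0 \<ge> B - 2 * M * F (- 1 / \<eta>)"
        by (simp add: algebra_simps)
      then show ?thesis
        using right[OF 2] y bump0 par[of 0 y] unfolding v_def by linarith
    next
      case 3
      have "(A - B) * heat_step d 0 y 0 \<le> (2 * M) * F (- 1 / \<eta>)"
        using F_far[OF 3] d M \<open>M \<ge> 0\<close> F01 by (intro mult_mono) (auto simp: heat_step_def)
      then have "A + (B - A) * heat_step d 0 y 0 \<ge> A - 2 * M * F (- 1 / \<eta>)"
        by (simp add: algebra_simps)
      then show ?thesis
        using left[of "- y"] 3 y bump0 par[of 0 y] unfolding v_def by auto
    qed
  next
    fix t :: real assume t: "0 \<le> t" "t \<le> 1"
    have "M \<le> v y t" if "\<bar>y\<bar> = R" for y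
    proof -
      have "y\<^sup>2 = R\<^sup>2" using that by (metis power2_abs)
      \<comment> \<open>At the lateral ends the parabola alone supplies the required
        \<open>2 * M\<close>.\<close>
      then have "2 * M / R\<^sup>2 * (y\<^sup>2 + 2 * t) \<ge> 2 * M"
        using \<open>M \<ge> 0\<close> \<open>R > 0\<close> t by (simp add: field_simps)
      moreover have "A + (B - A) * heat_step d 0 y t \<ge> - M"
        by (intro step) (auto simp: heat_step_def F_nonneg F_le_1)
      moreover have "4 * M * (heat_step d (- 2 * \<eta>) y t - heat_step d (2 * \<eta>) y t) \<ge> 0"
        using bump[of t y] \<open>M \<ge> 0\<close> t by simp
      ultimately show ?thesis
        using small unfolding v_def by linarith
    qed
    from this[of R] this[of "-R"] show "w (- R) t \<le> v (- R) t \<and> w R t \<le> v R t"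
      using M(1)[OF t(1), of R] M(1)[OF t(1), of "- R"] \<open>R > 0\<close> by auto
  qed (use x \<open>L < R\<close> in auto)
  moreover have "v x 1 \<le> F (- x) * A + F x * B + (2 * M * (L * d) + 16 * M * \<eta> + 2 * M * F (- 1 / \<eta>))
    + 2 * M * (L\<^sup>2 + 2) / R\<^sup>2 + \<omega>"
  proof -
    have "(B - A) * (heat_step d 0 x 1 - F x) \<le> \<bar>B - A\<bar> * \<bar>heat_step d 0 x 1 - F x\<bar>"
      by (metis abs_ge_self abs_mult)
    also have "\<dots> \<le> (2 * M) * (L * d)"
      using F_rescale_le[of d x L] M \<open>M \<ge> 0\<close> d x by (intro mult_mono) (auto simp: heat_step_def)
    finally have 1: "A + (B - A) * heat_step d 0 x 1 \<le> F (- x) * A + F x * B + 2 * M * (L * d)"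
      by (simp add: F_minus algebra_simps)
    \<comment> \<open>By time 1 the bump has spread: its two edges are translates by
      \<open>4 * \<eta>\<close>, so the Lipschitz bound makes it small.\<close>
    have "heat_step d (- 2 * \<eta>) x 1 - heat_step d (2 * \<eta>) x 1
        \<le> \<bar>(x - (- 2 * \<eta>)) / sqrt (1 + d) - (x - 2 * \<eta>) / sqrt (1 + d)\<bar>"
      unfolding heat_step_def using F_lipschitz abs_le_D1 by blast
    also have "\<dots> = 4 * \<eta> / sqrt (1 + d)"
      using \<eta> d by (simp add: diff_divide_distrib[symmetric])
    also have "\<dots> \<le> 4 * \<eta>"
      using \<eta> d by (simp add: divide_le_eq mult_le_cancel_left1)
    finally have "4 * M * (heat_step d (- 2 * \<eta>) x 1 - heat_step d (2 * \<eta>) x 1) \<le> 4 * M * (4 * \<eta>)"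
      using \<open>M \<ge> 0\<close> by (intro mult_left_mono) auto
    moreover have "2 * M / R\<^sup>2 * (x\<^sup>2 + 2 * 1) \<le> 2 * M / R\<^sup>2 * (L\<^sup>2 + 2)"
      using x \<open>M \<ge> 0\<close> power_mono[OF x, of 2] by (intro mult_left_mono) auto
    ultimately show ?thesis
      using 1 unfolding v_def by (simp add: algebra_simps)
  qed
  ultimately show ?thesis
    using d by (simp add: d_def)
qed

section \<open>Passage to large times\<close>

text \<open>Beyond \<open>X\<close> the derivative is at most \<open>\<gamma> / X\<close>, and the
  mean value inequality applies. With \<open>X\<close>, \<open>a\<close> and \<open>b\<close> all
  proportional to \<open>sqrt t\<close> the bound does not depend on \<open>t\<close>.\<close>

lemma slow_variation:
  fixes f f' :: "real \<Rightarrow> real"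
  assumes f: "\<And>x. (f has_real_derivative f' x) (at x)"
    and small: "\<And>x. x \<ge> X \<Longrightarrow> \<bar>x * f' x\<bar> \<le> \<gamma>" and "X > 0" "a \<ge> X" "b \<ge> X"
  shows "\<bar>f b - f a\<bar> \<le> \<gamma> / X * \<bar>b - a\<bar>"
proof -
  have "norm (f b - f a) \<le> \<gamma> / X * norm (b - a)"
  proof (rule field_differentiable_bound[of "{X..}" f f'])
    fix x assume "x \<in> {X..}"
    then have "X * \<bar>f' x\<bar> \<le> x * \<bar>f' x\<bar>" by (intro mult_right_mono) auto
    also have "\<dots> \<le> \<gamma>" using small[of x] \<open>x \<in> {X..}\<close> \<open>X > 0\<close> by (simp add: abs_mult)
    finally show "norm (f' x) \<le> \<gamma> / X"
      using \<open>X > 0\<close> by (simp add: field_simps)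
  qed (use assms in \<open>auto intro: has_field_derivative_at_within\<close>)
  then show ?thesis by simp
qed

text \<open>The parameters are chosen in the order \<open>\<eta>\<close>, \<open>R\<close>,
  \<open>\<gamma>\<close>, \<open>X\<close>, and finally \<open>t\<close>. Four errors of at most
  \<open>e / 4\<close> arise: the bracket in \<open>\<eta>\<close>, the parabola, the oscillation of
  \<open>u0\<close>, and the supersolution correction.\<close>

lemma graph_flow_upper_asymptotics:
  fixes u :: "real \<Rightarrow> real \<Rightarrow> real" and u0 u0' :: "real \<Rightarrow> real"
  assumes flow: "graph_flow 1 u" and init: "\<And>x. u x 0 = u0 x"
    and M: "\<And>x. \<bar>u0 x\<bar> \<le> M"
    and deriv: "\<And>x. (u0 has_real_derivative u0' x) (at x)"
    and lim: "((\<lambda>x. \<bar>x * u0' x\<bar>) \<longlongrightarrow> 0) at_infinity"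
    and "L > 0" "e > 0"
  shows "\<forall>\<^sub>F t in at_top. \<forall>x\<in>{-L..L}.
           u (sqrt t * x) t \<le> F (- x) * u0 (- sqrt t) + F x * u0 (sqrt t) + e"
proof -
  have M0: "M \<ge> 0" using M[of 0] by linarith
  have uM: "u x t \<le> M" if "t \<ge> 0" for x t
    using graph_flow_le_initial_bound[OF flow _ that, of M] M init by (auto simp: abs_le_iff)
  have Ftop: "((\<lambda>\<eta>. F (1 / \<eta>)) \<longlongrightarrow> 1) (at_right 0)"
    by (rule filterlim_compose[OF tendsto_F(1)]) real_asymp
  have Fbot: "((\<lambda>\<eta>. F (- 1 / \<eta>)) \<longlongrightarrow> 0) (at_right 0)"
    by (rule filterlim_compose[OF tendsto_F(2)]) real_asymp
  have "((\<lambda>\<eta>. 2 * M * (L * \<eta>^4) + 16 * M * \<eta> + 2 * M * F (- 1 / \<eta>)) \<longlongrightarrow>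
      2 * M * (L * 0^4) + 16 * M * 0 + 2 * M * 0) (at_right 0)"
    by (intro tendsto_intros Fbot)
  then have "\<forall>\<^sub>F \<eta> in at_right 0. 2 * M * (L * \<eta>^4) + 16 * M * \<eta> + 2 * M * F (- 1 / \<eta>) < e / 4"
    using \<open>e > 0\<close> by (intro order_tendstoD(2)) auto
  moreover have "\<forall>\<^sub>F \<eta> in at_right 0. F (1 / \<eta>) > 3 / 4"
    by (rule order_tendstoD(1)[OF Ftop]) simp
  moreover have "\<forall>\<^sub>F \<eta> in at_right 0. \<eta> \<in> {0<..<1::real}"
    by (rule eventually_at_right_real) simp
  ultimately have "\<forall>\<^sub>F \<eta> in at_right 0. 2 * M * (L * \<eta>^4) + 16 * M * \<eta> + 2 * M * F (- 1 / \<eta>) < e / 4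
      \<and> F (1 / \<eta>) > 3 / 4 \<and> \<eta> \<in> {0<..<1}"
    by eventually_elim simp
  then obtain \<eta> where \<eta>: "2 * M * (L * \<eta>^4) + 16 * M * \<eta> + 2 * M * F (- 1 / \<eta>) < e / 4"
      "F (1 / \<eta>) > 3 / 4" "0 < \<eta>" "\<eta> < 1"
    using eventually_happens[of _ "at_right (0::real)"] by (auto simp: trivial_limit_at_right_real)
  have "((\<lambda>R. 2 * M * (L\<^sup>2 + 2) / R\<^sup>2) \<longlongrightarrow> 0) at_top"
    by real_asymp
  then have "\<forall>\<^sub>F R in at_top. 2 * M * (L\<^sup>2 + 2) / R\<^sup>2 < e / 4"
    using \<open>e > 0\<close> by (intro order_tendstoD(2)) auto
  moreover have "\<forall>\<^sub>F R in at_top. R > max L 1" by (rule eventually_gt_at_top)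
  ultimately have "\<forall>\<^sub>F R in at_top. 2 * M * (L\<^sup>2 + 2) / R\<^sup>2 < e / 4 \<and> R > max L 1"
    by (rule eventually_conj)
  then obtain R where R: "2 * M * (L\<^sup>2 + 2) / R\<^sup>2 < e / 4" "R > L" "R > 1"
    using eventually_happens[of _ "at_top :: real filter"] by (auto simp: trivial_limit_at_top_linorder)
  \<comment> \<open>Chosen so that \<open>\<gamma> / \<eta> * (R + 1)\<close>, which bounds the
    variation of \<open>u0\<close> between \<open>r\<close> and \<open>r * x\<close> for
    \<open>x\<close> from \<open>\<eta>\<close> to \<open>R\<close>, equals
    \<open>e / 4\<close>.\<close>
  define \<gamma> where "\<gamma> = e / 4 * \<eta> / (R + 1)"
  have "\<gamma> > 0" using \<eta> R \<open>e > 0\<close> by (simp add: \<gamma>_def)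
  obtain X where X: "\<And>x. \<bar>x\<bar> \<ge> X \<Longrightarrow> \<bar>x * u0' x\<bar> \<le> \<gamma>"
    using order_tendstoD(2)[OF lim \<open>\<gamma> > 0\<close>] unfolding eventually_at_infinity
    by (metis less_imp_le real_norm_def)
  \<comment> \<open>After rescaling, \<open>\<mu>\<close> is \<open>1 / t\<close>, so the
    supersolution correction at time 1 is \<open>1 / t * C\<close> and vanishes in the
    limit.\<close>
  define C where "C = (10 * M / \<eta>^4 + 4 * M / R\<^sup>2) * (10 * M / \<eta>\<^sup>2 + 4 * M / R)\<^sup>2"
  have "((\<lambda>t. 1 / t * C) \<longlongrightarrow> 0) at_top"
    by real_asymp
  then have "\<forall>\<^sub>F t in at_top. 1 / t * C < e / 4"
    using \<open>e > 0\<close> by (intro order_tendstoD(2)) auto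
  moreover have "\<forall>\<^sub>F t in at_top. sqrt t * \<eta> > max X 0"
    using \<eta>(3) by real_asymp
  ultimately show ?thesis
    using eventually_gt_at_top[of 0]
  proof eventually_elim
    case (elim t)
    define r where "r = sqrt t"
    have r: "r > 0" "r\<^sup>2 = t" "r * \<eta> > X" using elim by (auto simp: r_def)
    have near: "\<bar>f (r * x) - f r\<bar> \<le> e / 4"
      if f: "\<And>x. (f has_real_derivative f' x) (at x)" and f': "\<And>x. x \<ge> r * \<eta> \<Longrightarrow> \<bar>x * f' x\<bar> \<le> \<gamma>"
        and x: "\<eta> \<le> x" "x \<le> R" for f f' x
    proof -
      have "\<bar>f (r * x) - f r\<bar> \<le> \<gamma> / (r * \<eta>) * \<bar>r * x - r\<bar>"
        by (rule slow_variation[OF f f']) (use r \<eta> x in auto)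
      also have "\<dots> = \<gamma> / \<eta> * \<bar>x - 1\<bar>"
      proof -
        have "r * x - r = r * (x - 1)" by (simp add: algebra_simps)
        then show ?thesis using r \<eta> by (simp add: abs_mult)
      qed
      also have "\<dots> \<le> \<gamma> / \<eta> * (R + 1)"
        using x \<eta> R \<open>\<gamma> > 0\<close> by (intro mult_left_mono) auto
      also have "\<dots> = e / 4"
      proof -
        have "\<gamma> / \<eta> = e / 4 / (R + 1)" "R + 1 \<noteq> 0"
          using \<eta> R by (auto simp: \<gamma>_def)
        then show ?thesis by (metis nonzero_divide_eq_eq)
      qed
      finally show ?thesis .
    qed
    have right: "u0 (r * x) \<le> u0 r + e / 4" if "\<eta> \<le> x" "x \<le> R" for x
    proof -
      have "\<bar>u0 (r * x) - u0 r\<bar> \<le> e / 4"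
        by (rule near[OF deriv _ that], rule X) (use r in linarith)
      then show ?thesis by linarith
    qed
    \<comment> \<open>The left half-line is reduced to the right one by reflecting
      \<open>u0\<close>.\<close>
    have deriv': "((\<lambda>x. u0 (- x)) has_real_derivative - u0' (- x)) (at x)" for x
      using DERIV_chain2[OF deriv DERIV_minus[OF DERIV_ident]] by simp
    have left: "u0 (r * - x) \<le> u0 (- r) + e / 4" if "\<eta> \<le> x" "x \<le> R" for x
    proof -
      have "\<bar>y * - u0' (- y)\<bar> \<le> \<gamma>" if "r * \<eta> \<le> y" for y
        using X[of "- y"] that r by simp
      from near[OF deriv' this \<open>\<eta> \<le> x\<close> \<open>x \<le> R\<close>]
      have "\<bar>u0 (r * - x) - u0 (- r)\<bar> \<le> e / 4" by simp
      then show ?thesis by linarith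
    qed
    show ?case
    proof
      fix x assume "x \<in> {-L..L}"
      then have "\<bar>x\<bar> \<le> L" by auto
      have "u (r * x) (r\<^sup>2 * 1) \<le> F (- x) * u0 (- r) + F x * u0 r
          + (2 * M * (L * \<eta>^4) + 16 * M * \<eta> + 2 * M * F (- 1 / \<eta>))
          + 2 * M * (L\<^sup>2 + 2) / R\<^sup>2 + e / 4
          + 1 / r\<^sup>2 * (10 * M / \<eta>^4 + 4 * M / R\<^sup>2) * (10 * M / \<eta>\<^sup>2 + 4 * M / R)\<^sup>2"
        by (rule graph_flow_le_step[OF graph_flow_rescale[OF flow r(1)]])
           (use uM M \<eta> \<open>e > 0\<close> right left init \<open>\<bar>x\<bar> \<le> L\<close> R in auto)
      then have "u (r * x) t \<le> F (- x) * u0 (- r) + F x * u0 r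
          + (2 * M * (L * \<eta>^4) + 16 * M * \<eta> + 2 * M * F (- 1 / \<eta>))
          + 2 * M * (L\<^sup>2 + 2) / R\<^sup>2 + e / 4 + 1 / t * C"
        unfolding C_def r(2) by (simp add: mult.assoc)
      then show "u (sqrt t * x) t \<le> F (- x) * u0 (- sqrt t) + F x * u0 (sqrt t) + e"
        using \<eta>(1) R(1) elim(1) unfolding r_def by linarith
    qed
  qed
qed

theorem corollary8:
  fixes u0 :: "real \<Rightarrow> real" and u :: "real \<Rightarrow> real \<Rightarrow> real" and \<epsilon> :: real
  assumes "\<epsilon> > 0"
    and "C2 u0"
    and "bdd_above (range (\<lambda>x. \<bar>u0 x\<bar> + \<bar>deriv u0 x\<bar> + \<bar>deriv (deriv u0) x\<bar>))"
    and "bdd_above {\<bar>deriv (deriv u0) x1 - deriv (deriv u0) x2\<bar> / \<bar>x1 - x2\<bar> powr \<epsilon> | x1 x2. x1 \<noteq> x2}"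
    and "((\<lambda>x. \<bar>x * deriv u0 x\<bar>) \<longlongrightarrow> 0) at_infinity"
    and "classical_solution u0 u"
  shows "\<forall>L>0. ((\<lambda>t. SUP x\<in>{-L..L}. \<bar>u (sqrt t * x) t
            - (F (- x) * u0 (- sqrt t) + F x * u0 (sqrt t))\<bar>) \<longlongrightarrow> 0) at_top"
proof (intro allI impI)
  fix L :: real assume "L > 0"
  obtain M where "\<And>x. \<bar>u0 x\<bar> + \<bar>deriv u0 x\<bar> + \<bar>deriv (deriv u0) x\<bar> \<le> M"
    using assms(3) by (auto simp: bdd_above_def)
  then have M: "\<bar>u0 x\<bar> \<le> M" for x
    using abs_ge_zero[of "deriv u0 x"] abs_ge_zero[of "deriv (deriv u0) x"] by (smt (verit, best))
  have deriv: "(u0 has_real_derivative deriv u0 x) (at x)" for x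
    using assms(2) by (simp add: C2_def DERIV_deriv_iff_real_differentiable)
  have flow: "graph_flow 1 u" and init: "u x 0 = u0 x" for x
    using graph_flow_classical_solution[OF assms(6)] assms(6) by (auto simp: classical_solution_def)
  let ?d = "\<lambda>t x. \<bar>u (sqrt t * x) t - (F (- x) * u0 (- sqrt t) + F x * u0 (sqrt t))\<bar>"
  show "((\<lambda>t. SUP x\<in>{-L..L}. ?d t x) \<longlongrightarrow> 0) at_top"
  proof (rule tendstoI)
    fix e :: real assume "e > 0"
    have "\<forall>\<^sub>F t in at_top. \<forall>x\<in>{-L..L}.
        u (sqrt t * x) t \<le> F (- x) * u0 (- sqrt t) + F x * u0 (sqrt t) + e / 2"
      using graph_flow_upper_asymptotics[OF flow init M deriv assms(5) \<open>L > 0\<close>, of "e / 2"] \<open>e > 0\<close> by simp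
    moreover have "\<forall>\<^sub>F t in at_top. \<forall>x\<in>{-L..L}.
        - u (sqrt t * x) t \<le> F (- x) * - u0 (- sqrt t) + F x * - u0 (sqrt t) + e / 2"
      using graph_flow_upper_asymptotics[OF graph_flow_minus[OF flow], of "\<lambda>x. - u0 x" M "\<lambda>x. - deriv u0 x" L "e / 2"]
        init M DERIV_minus[OF deriv] assms(5) \<open>L > 0\<close> \<open>e > 0\<close> by simp
    ultimately show "\<forall>\<^sub>F t in at_top. dist (SUP x\<in>{-L..L}. ?d t x) 0 < e"
    proof eventually_elim
      case (elim t)
      then have le: "?d t x \<le> e / 2" if "x \<in> {-L..L}" for x
      proof -
        have "u (sqrt t * x) t \<le> F (- x) * u0 (- sqrt t) + F x * u0 (sqrt t) + e / 2"
          "- u (sqrt t * x) t \<le> - (F (- x) * u0 (- sqrt t)) - F x * u0 (sqrt t) + e / 2"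
          using elim that by auto
        then show ?thesis by linarith
      qed
      have "(SUP x\<in>{-L..L}. ?d t x) \<le> e / 2"
        by (rule cSUP_least) (use le \<open>L > 0\<close> in auto)
      \<comment> \<open>One value below the supremum shows it to be nonnegative, so its distance to
        0 is the supremum itself.\<close>
      moreover have "?d t 0 \<le> (SUP x\<in>{-L..L}. ?d t x)"
        by (rule cSUP_upper[OF _ bdd_aboveI2[OF le]]) (use \<open>L > 0\<close> in auto)
      ultimately show ?case
        using \<open>e > 0\<close> by simp
    qed
  qed
qed

end
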